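(* Let $\underline a=\{a_n\}_{n=0}^\infty$ be a (strictly) increasing sequence of non-negative integers, and put $x_n=2^{-(a_n+1)}$ (viewed as an element of $\mathbb{T}=\mathbb{R}/\mathbb{Z}$) and $g_n=a_{n+1}-a_n$. The set $K_{\underline a,2}=\{0\}\cup\{\pm x_n\mid n\in\mathbb{N}\}$ is quasi-convex in $\mathbb{T}$ if and only if the following three conditions hold: (i) $a_0>0$; (ii) $g_n>1$ for all but possibly one index $n\in\mathbb{N}$; (iii) if $g_n=1$ for some $n\in\mathbb{N}$, then $g_{n+1}>2$.
   Context: $\mathbb{N}$ includes $0$. $\mathbb{T}=\mathbb{R}/\mathbb{Z}$ with canonical projection $\pi\colon\mathbb{R}\to\mathbb{T}$; real numbers are identified with their images in $\mathbb{T}$. Put $\mathbb{T}_+=\pi([-\frac14,\frac14])$. For an abelian topological group $G$, $\widehat G$ is the group of characters, i.e. continuous homomorphisms $G\to\mathbb{T}$. For $E\subseteq G$ and $A\subseteq\widehat G$ put $E^\triangleright=\{\chi\in\widehat G\mid\chi(E)\subseteq\mathbb{T}_+\}$ and $A^\triangleleft=\{x\in G\mid\chi(x)\in\mathbb{T}_+\text{ for all }\chi\in A\}$. The set $E$ is quasi-convex in $G$ if $E=E^{\triangleright\triangleleft}$; equivalently, for every $x\in G\setminus E$ there is $\chi\in E^\triangleright$ with $\chi(x)\notin\mathbb{T}_+$. *)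

theory Defs
  imports "HOL-Analysis.Analysis"
begin

quotient_type circle = real / "\<lambda>x y :: real. x - y \<in> \<int>"
  morphisms rep_circle to_circle
proof (rule equivpI)
  show "reflp (\<lambda>x y :: real. x - y \<in> \<int>)"
    by (simp add: reflp_def)
  show "symp (\<lambda>x y :: real. x - y \<in> \<int>)"
    by (metis (mono_tags, lifting) Ints_minus minus_diff_eq sympI)
  show "transp (\<lambda>x y :: real. x - y \<in> \<int>)"
  proof (rule transpI)
    fix x y z :: real
    assume "x - y \<in> \<int>" "y - z \<in> \<int>"
    then have "(x - y) + (y - z) \<in> \<int>" by (rule Ints_add)
    then show "x - z \<in> \<int>" by simp
  qed
qed

instantiation circle :: ab_group_add
begin

lift_definition zero_circle :: circle is "0 :: real" .

lift_definition plus_circle :: "circle \<Rightarrow> circle \<Rightarrow> circle" is "(+) :: real \<Rightarrow> real \<Rightarrow> real"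
proof -
  fix x x' y y' :: real
  assume "x - x' \<in> \<int>" "y - y' \<in> \<int>"
  then have "(x - x') + (y - y') \<in> \<int>" by (rule Ints_add)
  then show "(x + y) - (x' + y') \<in> \<int>" by (simp add: algebra_simps)
qed

lift_definition uminus_circle :: "circle \<Rightarrow> circle" is "uminus :: real \<Rightarrow> real"
proof -
  fix x x' :: real
  assume "x - x' \<in> \<int>"
  then have "- (x - x') \<in> \<int>" by (rule Ints_minus)
  then show "- x - - x' \<in> \<int>" by (simp add: algebra_simps)
qed

lift_definition minus_circle :: "circle \<Rightarrow> circle \<Rightarrow> circle" is "(-) :: real \<Rightarrow> real \<Rightarrow> real"
proof -
  fix x x' y y' :: real
  assume "x - x' \<in> \<int>" "y - y' \<in> \<int>"
  then have "(x - x') - (y - y') \<in> \<int>" by (rule Ints_diff)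
  then show "(x - y) - (x' - y') \<in> \<int>" by (simp add: algebra_simps)
qed

instance
  by standard (transfer; simp add: algebra_simps)+

end

lemma to_circle_add: "to_circle (x + y) = to_circle x + to_circle y"
  by (simp add: plus_circle.abs_eq)

lemma to_circle_minus: "to_circle (- x) = - to_circle x"
  by (simp add: uminus_circle.abs_eq)

lemma to_circle_eq_iff: "to_circle x = to_circle y \<longleftrightarrow> x - y \<in> \<int>"
  by (simp add: circle.abs_eq_iff)

lemma to_circle_cases: obtains x where "c = to_circle x"
  by (metis Quotient3_abs_rep Quotient3_circle)

instantiation circle :: topological_space
begin

text \<open>The quotient topology.\<close>

definition open_circle :: "circle set \<Rightarrow> bool" where
  "open_circle U \<longleftrightarrow> open (to_circle -` U)"

instance
  by standard (auto simp: open_circle_def vimage_Union)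

end

lemma continuous_to_circle: "continuous_on A to_circle"
  by (rule continuous_on_subset[of UNIV])
    (auto simp: continuous_on_open_vimage open_circle_def)

lemma open_to_circle_image:
  assumes "open U"
  shows "open (to_circle ` U)"
proof -
  have "to_circle -` (to_circle ` U) = (\<Union>k\<in>\<int>. (\<lambda>x. x + k) ` U)" (is "?L = ?R")
  proof (intro equalityI subsetI)
    fix x assume "x \<in> ?L"
    then obtain u where "u \<in> U" "x - u \<in> \<int>" by (auto simp: to_circle_eq_iff)
    moreover have "x = u + (x - u)" by simp
    ultimately show "x \<in> ?R" by blast
  next
    fix x assume "x \<in> ?R"
    then obtain u k where "u \<in> U" "k \<in> \<int>" "x = u + k" by blast
    moreover from this have "to_circle x = to_circle u" by (simp add: to_circle_eq_iff)
    ultimately show "x \<in> ?L" by simp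
  qed
  moreover have "open (\<Union>k\<in>\<int>. (\<lambda>x. x + k) ` U)"
  proof (intro open_UN ballI)
    fix k :: real
    have "open ((\<lambda>x. k + x) ` U)" using assms by (rule open_translation)
    then show "open ((\<lambda>x. x + k) ` U)" by (simp add: add.commute)
  qed
  ultimately show ?thesis by (simp add: open_circle_def)
qed

instance circle :: topological_ab_group_add
proof
  have cont: "isCont to_circle x" for x
    using continuous_to_circle[of UNIV] by (simp add: continuous_on_eq_continuous_at)
  fix a b :: circle
  obtain x where x: "a = to_circle x" by (rule to_circle_cases)
  obtain y where y: "b = to_circle y" by (rule to_circle_cases)
  show "((\<lambda>z. fst z + snd z) \<longlongrightarrow> a + b) (nhds a \<times>\<^sub>F nhds b)"
  proof (rule topological_tendstoI)
    fix S assume S: "open S" "a + b \<in> S"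
    have "((\<lambda>z. to_circle (fst z + snd z)) \<longlongrightarrow> to_circle (x + y)) (nhds x \<times>\<^sub>F nhds y)"
      by (intro isCont_tendsto_compose[OF cont] tendsto_add_Pair)
    with S have "\<forall>\<^sub>F z in nhds x \<times>\<^sub>F nhds y. to_circle (fst z + snd z) \<in> S"
      by (auto simp: x y to_circle_add dest: topological_tendstoD)
    then obtain P Q where PQ: "eventually P (nhds x)" "eventually Q (nhds y)"
      "\<And>u v. P u \<Longrightarrow> Q v \<Longrightarrow> to_circle (u + v) \<in> S"
      by (auto simp: eventually_prod_filter)
    obtain U where U: "open U" "x \<in> U" "\<And>u. u \<in> U \<Longrightarrow> P u"
      using PQ(1) by (auto simp: eventually_nhds)
    obtain V where V: "open V" "y \<in> V" "\<And>v. v \<in> V \<Longrightarrow> Q v"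
      using PQ(2) by (auto simp: eventually_nhds)
    have "\<forall>\<^sub>F c in nhds a. c \<in> to_circle ` U"
      using U by (auto simp: x intro: eventually_nhds_in_open open_to_circle_image)
    moreover have "\<forall>\<^sub>F d in nhds b. d \<in> to_circle ` V"
      using V by (auto simp: y intro: eventually_nhds_in_open open_to_circle_image)
    moreover have "c + d \<in> S" if "c \<in> to_circle ` U" "d \<in> to_circle ` V" for c d
      using that PQ(3) U(3) V(3) by (auto simp: to_circle_add)
    ultimately show "\<forall>\<^sub>F z in nhds a \<times>\<^sub>F nhds b. fst z + snd z \<in> S"
      unfolding eventually_prod_filter fst_conv snd_conv by blast
  qed
  show "(uminus \<longlongrightarrow> - a) (nhds a)"
  proof (rule topological_tendstoI)
    fix S assume S: "open S" "- a \<in> S"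
    have "open (uminus -` (to_circle -` S))"
      using S(1) by (intro open_vimage[of "to_circle -` S" uminus])
        (auto simp: open_circle_def intro!: continuous_intros)
    moreover have "uminus -` (to_circle -` S) = to_circle -` (uminus -` S)"
      by (simp add: set_eq_iff to_circle_minus)
    ultimately have "open (uminus -` S)" by (simp add: open_circle_def)
    with S(2) show "\<forall>\<^sub>F c in nhds a. - c \<in> S"
      using eventually_nhds_in_open[of "uminus -` S" a] by simp
  qed
qed

definition circle_plus :: "circle set" where
  "circle_plus = to_circle ` {-1/4..1/4}"

definition characters :: "('a::topological_ab_group_add \<Rightarrow> circle) set" where
  "characters = {\<phi>. continuous_on UNIV \<phi> \<and> (\<forall>x y. \<phi> (x + y) = \<phi> x + \<phi> y)}"

definition polar :: "'a::topological_ab_group_add set \<Rightarrow> ('a \<Rightarrow> circle) set" where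
  "polar E = {\<phi> \<in> characters. \<phi> ` E \<subseteq> circle_plus}"

definition prepolar :: "('a::topological_ab_group_add \<Rightarrow> circle) set \<Rightarrow> 'a set" where
  "prepolar A = {x. \<forall>\<phi>\<in>A. \<phi> x \<in> circle_plus}"

definition quasi_convex :: "'a::topological_ab_group_add set \<Rightarrow> bool" where
  "quasi_convex E \<longleftrightarrow> E = prepolar (polar E)"

definition dyadic_pt :: "(nat \<Rightarrow> nat) \<Rightarrow> nat \<Rightarrow> circle" where
  "dyadic_pt a n = to_circle (1 / 2 ^ (a n + 1))"

definition K2 :: "(nat \<Rightarrow> nat) \<Rightarrow> circle set" where
  "K2 a = {0} \<union> {dyadic_pt a n | n. True} \<union> {- dyadic_pt a n | n. True}"

text \<open>Truncated subtraction is harmless here because the sequences considered are increasing.\<close>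

definition gap :: "(nat \<Rightarrow> nat) \<Rightarrow> nat \<Rightarrow> nat" where
  "gap a n = a (n + 1) - a n"

end

(*
Let A be the range of a. Multiplication by k = 2^i - 2^j is in the polar of K whenever i and j lie
outside A, because 2^i x_n is then congruent to a number in [0, 1/4]. Given x = u mod 1 in the
bipolar with 0 < u <= 1/4, let 2^e u be the last doubling before the orbit of u first leaves
[-1/4, 1/4] mod 1; then e + 1 lies in A. Unless u = 2^-(e+2), the orbit comes back near 0, normally
with the opposite sign, and leaves again, say just after 2^j u. Both 2^e u and 2^j u then have
distance between 1/8 and 1/4 from the integers, in opposite directions, so that 2^e - 2^j (near a
pair of consecutive elements of A, a variant with e or j shifted) sends u out of [-1/4, 1/4] mod 1.
If e + 1 and e + 2 both lie in A, the orbit may come back with the same sign and only the third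
return has the opposite sign; when there is no third return, u = 2^-(e+3) + 2^-(j+2), and the
three-term character 2^e - 2^(e+3) + 2^j is needed.

Conversely, when a condition fails, an explicit point outside K lies in the bipolar:
1/2 - x_2 if a_0 = 0; 3/2^(p+3) if p, p + 1, p + 2 are in A; 5/2^(p+4) if p, p + 1, p + 3 are in A;
and 1/2^(p+2) + 1/2^(q+2) if p, p + 1, q, q + 1 are in A. If p, p + 1 are in A, then the value of a
polar character at 1/2^(p+2) is confined to [-1/8, 1/8].
*)

theory Submission
  imports Defs
begin

section \<open>Points of the circle near zero\<close>

text \<open>Pulls \<open>circle_plus\<close> back along the projection, which turns questions about
  the circle into linear arithmetic on reals.\<close>

definition near_int :: "real \<Rightarrow> bool" where
  "near_int z \<longleftrightarrow> (\<exists>n::int. \<bar>z - of_int n\<bar> \<le> 1/4)"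

lemma near_intI: "\<bar>z - of_int n\<bar> \<le> 1/4 \<Longrightarrow> near_int z"
  unfolding near_int_def by blast

lemma near_int_add_of_intI: "z = r + of_int n \<Longrightarrow> - 1/4 \<le> r \<Longrightarrow> r \<le> 1/4 \<Longrightarrow> near_int z"
  by (intro near_intI[of _ n]) (simp only: add_diff_cancel_right' abs_le_iff, simp)

lemma near_int_add_of_int: "near_int (z + of_int m) \<longleftrightarrow> near_int z"
proof
  assume "near_int z"
  then obtain n where "\<bar>z - of_int n\<bar> \<le> 1/4" unfolding near_int_def by blast
  then show "near_int (z + of_int m)" by (intro near_intI[of _ "n + m"]) simp
next
  assume "near_int (z + of_int m)"
  then obtain n where "\<bar>z + of_int m - of_int n\<bar> \<le> 1/4" unfolding near_int_def by blast
  then show "near_int z" by (intro near_intI[of _ "n - m"]) (simp add: algebra_simps)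
qed

lemma near_int_uminus: "near_int (- z) \<longleftrightarrow> near_int z"
proof -
  have "near_int (- z)" if "near_int z" for z
  proof -
    from that obtain n where "\<bar>z - of_int n\<bar> \<le> 1/4" unfolding near_int_def by blast
    then show ?thesis by (intro near_intI[of _ "- n"]) (unfold of_int_minus, linarith)
  qed
  from this[of z] this[of "- z"] show ?thesis by auto
qed

text \<open>Main source of contradictions: the open middle half of every unit interval is
  forbidden.\<close>

lemma near_int_gap:
  assumes "near_int z" "of_int m < z" "z < of_int m + 1"
  shows "z \<le> of_int m + 1/4 \<or> of_int m + 3/4 \<le> z"
proof -
  obtain n where n: "\<bar>z - of_int n\<bar> \<le> 1/4" using assms unfolding near_int_def by blast
  have "real_of_int n < of_int (m + 2)" "real_of_int (m - 1) < of_int n"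
    using n assms unfolding of_int_add of_int_diff by linarith+
  then have "n = m \<or> n = m + 1" by linarith
  then show ?thesis using n by (elim disjE; simp; linarith)
qed

lemma near_int_small:
  assumes "near_int z" "\<bar>z\<bar> \<le> 1/2" shows "\<bar>z\<bar> \<le> 1/4"
proof -
  have "near_int \<bar>z\<bar>" using assms(1) near_int_uminus[of z] by (simp add: abs_if)
  with near_int_gap[of "\<bar>z\<bar>" 0] assms(2) show ?thesis by fastforce
qed

lemma to_circle_in_circle_plus: "to_circle z \<in> circle_plus \<longleftrightarrow> near_int z"
proof
  assume "to_circle z \<in> circle_plus"
  then obtain y where y: "-1/4 \<le> y" "y \<le> 1/4" "z - y \<in> \<int>"
    by (auto simp: circle_plus_def to_circle_eq_iff)
  then obtain n where "z - y = of_int n" by (auto elim: Ints_cases)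
  then have "z = y + of_int n" by simp
  then show "near_int z" by (rule near_int_add_of_intI) (use y in auto)
next
  assume "near_int z"
  then obtain n where n: "\<bar>z - of_int n\<bar> \<le> 1/4" unfolding near_int_def by blast
  have "to_circle z = to_circle (z - of_int n)" by (simp add: to_circle_eq_iff)
  moreover have "z - of_int n \<in> {-1/4..1/4}" using n unfolding atLeastAtMost_iff by linarith
  ultimately show "to_circle z \<in> circle_plus" unfolding circle_plus_def by blast
qed

lemma circle_plusE:
  assumes "c \<in> circle_plus"
  obtains v where "c = to_circle v" "\<bar>v\<bar> \<le> 1/4"
  using assms unfolding circle_plus_def by (auto simp: abs_le_iff)

lemma to_circle_0: "to_circle 0 = 0"
  by (simp add: zero_circle_def)

section \<open>Characters of the circle\<close>

text \<open>Multiplications by integers are the test characters for sufficiency.\<close>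

lift_definition int_mult :: "int \<Rightarrow> circle \<Rightarrow> circle" is "\<lambda>k z. of_int k * z"
proof -
  fix k :: int and x y :: real
  assume "x - y \<in> \<int>"
  then have "of_int k * (x - y) \<in> \<int>" by (intro Ints_mult) auto
  then show "of_int k * x - of_int k * y \<in> \<int>" by (simp add: algebra_simps)
qed

lemma int_mult_to_circle: "int_mult k (to_circle z) = to_circle (of_int k * z)"
  by (rule int_mult.abs_eq)

lemma int_mult_character: "int_mult k \<in> characters"
proof -
  have "open (int_mult k -` U)" if "open U" for U
  proof -
    have "to_circle -` (int_mult k -` U) = (\<lambda>z. of_int k * z) -` (to_circle -` U)"
      by (auto simp: int_mult_to_circle)
    moreover have "open ((\<lambda>z. of_int k * z) -` (to_circle -` U))"
      using that unfolding open_circle_def by (rule open_vimage[of _ "\<lambda>z. of_int k * z"]) (intro continuous_intros)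
    ultimately show ?thesis by (simp add: open_circle_def)
  qed
  then have "continuous_on UNIV (int_mult k)" by (simp add: continuous_on_open_vimage)
  moreover have "int_mult k (x + y) = int_mult k x + int_mult k y" for x y
    by transfer (simp add: algebra_simps)
  ultimately show ?thesis by (simp add: characters_def)
qed

lemma character_0:
  assumes "\<phi> \<in> characters" shows "\<phi> 0 = 0"
proof -
  have "\<phi> (0 + 0) = \<phi> 0 + \<phi> 0" using assms unfolding characters_def by blast
  then show ?thesis by simp
qed

lemma character_add: "\<phi> \<in> characters \<Longrightarrow> \<phi> (x + y) = \<phi> x + \<phi> y"
  by (simp add: characters_def)

lemma character_uminus:
  assumes "\<phi> \<in> characters" shows "\<phi> (- x) = - \<phi> x"
proof -
  have "\<phi> (x + - x) = \<phi> x + \<phi> (- x)" using assms by (rule character_add)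
  then show ?thesis using character_0[OF assms] by (simp add: eq_neg_iff_add_eq_0 add.commute)
qed

text \<open>For necessity the characters are arbitrary; a real representative of the value at one
  point then controls the values at all its natural multiples.\<close>

lemma character_multiple:
  assumes "\<phi> \<in> characters" "\<phi> (to_circle z) = to_circle v"
  shows "\<phi> (to_circle (real n * z)) = to_circle (real n * v)"
proof (induction n)
  case 0
  then show ?case using character_0[OF assms(1)] by (simp add: to_circle_0)
next
  case (Suc n)
  then show ?case by (simp add: algebra_simps to_circle_add character_add assms)
qed

lemma uminus_circle_plus: "- c \<in> circle_plus \<longleftrightarrow> c \<in> circle_plus"
  by (metis near_int_uminus to_circle_cases to_circle_in_circle_plus to_circle_minus)

lemma zero_in_circle_plus: "0 \<in> circle_plus"
  unfolding to_circle_0[symmetric] to_circle_in_circle_plus by (rule near_intI[of _ 0]) simp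

text \<open>Characters are odd and fix 0, and \<open>circle_plus\<close> is symmetric about 0, so
  the points \<open>dyadic_pt a n\<close> decide.\<close>

lemma polar_K2:
  "\<phi> \<in> polar (K2 a) \<longleftrightarrow> \<phi> \<in> characters \<and> (\<forall>n. \<phi> (dyadic_pt a n) \<in> circle_plus)"
  unfolding polar_def K2_def
  by (auto simp: character_0 character_uminus zero_in_circle_plus uminus_circle_plus image_Un)

lemma int_mult_polar_K2:
  "int_mult k \<in> polar (K2 a) \<longleftrightarrow> (\<forall>b\<in>range a. near_int (of_int k / 2 ^ Suc b))"
  by (simp add: polar_K2 int_mult_character dyadic_pt_def int_mult_to_circle to_circle_in_circle_plus)

lemma quasi_convex_iff: "quasi_convex E \<longleftrightarrow> prepolar (polar E) \<subseteq> E"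
  unfolding quasi_convex_def prepolar_def polar_def by auto

section \<open>Sufficiency\<close>

lemma scale_to_quarter:
  fixes v :: real
  assumes "0 < v" "v \<le> 1/4"
  obtains f where "1/8 < 2 ^ f * v" "2 ^ f * v \<le> 1/4"
proof -
  obtain m where m: "1 / (8 * v) < 2 ^ m"
    using real_arch_pow[of 2 "1 / (8 * v)"] by auto
  \<comment> \<open>By minimality the preceding exponent gives at most 1/8, so one more doubling
    stays within 1/4.\<close>
  define f where "f = (LEAST m. 1/8 < 2 ^ m * v)"
  have ex: "1/8 < 2 ^ m * v" using m assms by (simp add: field_simps)
  have 1: "1/8 < 2 ^ f * v" unfolding f_def using ex by (rule LeastI)
  have 2: "2 ^ f * v \<le> 1/4"
  proof (cases f)
    case 0
    then show ?thesis using assms by simp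
  next
    case (Suc g)
    have "\<not> 1/8 < 2 ^ g * v" using Suc not_less_Least[of g "\<lambda>m. 1/8 < 2 ^ m * v"]
      unfolding f_def by simp
    then show ?thesis unfolding Suc by simp
  qed
  show ?thesis using that 1 2 by blast
qed

section \<open>Powers of two at dyadic points, and integer multipliers in the polar\<close>

lemma pow2_ratio_ge:
  assumes "b < i" shows "\<exists>n::int. (2::real) ^ i / 2 ^ Suc b = of_int n"
proof -
  have "(2::real) ^ i / 2 ^ Suc b = 2 ^ (i - Suc b)"
    using assms by (subst power_diff) auto
  also have "\<dots> = of_int (2 ^ (i - Suc b))" by simp
  finally show ?thesis by blast
qed

lemma pow2_ratio_less:
  assumes "i + d \<le> b" shows "0 < (2::real) ^ i / 2 ^ Suc b" "(2::real) ^ i / 2 ^ Suc b \<le> 1 / 2 ^ Suc d"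
proof -
  have "(2::real) ^ i * 2 ^ Suc d \<le> 2 ^ Suc b"
    unfolding power_add[symmetric] using assms by (intro power_increasing) auto
  then show "(2::real) ^ i / 2 ^ Suc b \<le> 1 / 2 ^ Suc d" by (simp add: field_simps)
qed simp

text \<open>The ratio is an integer for \<open>b < i\<close> and at most 1/4 for
  \<open>i < b\<close>; only \<open>i = b\<close> gives 1/2. Since the remainder is nonnegative, the
  difference of two such remainders stays in [-1/4, 1/4].\<close>

lemma pow2_ratio_cases:
  assumes "i \<noteq> b"
  shows "\<exists>n::int. \<exists>r. (2::real) ^ i / 2 ^ Suc b = of_int n + r \<and> 0 \<le> r \<and> r \<le> 1/4"
proof (cases "b < i")
  case True
  then show ?thesis using pow2_ratio_ge[of b i] by (metis add.right_neutral order_refl zero_le_divide_1_iff zero_le_numeral)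
next
  case False
  then have "i + 1 \<le> b" using assms by simp
  from pow2_ratio_less[OF this] show ?thesis
    by (intro exI[of _ 0] exI[of _ "2 ^ i / 2 ^ Suc b"]) auto
qed

lemma near_int_pow2_diff:
  assumes "i \<noteq> b" "j \<noteq> b"
  shows "near_int (of_int (2 ^ i - 2 ^ j) / 2 ^ Suc b)"
proof -
  obtain n r where 1: "(2::real) ^ i / 2 ^ Suc b = of_int n + r" "0 \<le> r" "r \<le> 1/4"
    using pow2_ratio_cases[OF assms(1)] by blast
  obtain m s where 2: "(2::real) ^ j / 2 ^ Suc b = of_int m + s" "0 \<le> s" "s \<le> 1/4"
    using pow2_ratio_cases[OF assms(2)] by blast
  have "of_int (2 ^ i - 2 ^ j) / 2 ^ Suc b = (2::real) ^ i / 2 ^ Suc b - 2 ^ j / 2 ^ Suc b"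
    by (simp add: diff_divide_distrib)
  also have "\<dots> = (r - s) + of_int (n - m)" unfolding 1 2 by simp
  finally show ?thesis by (rule near_int_add_of_intI) (use 1 2 in linarith)+
qed

lemma near_int_pow2:
  assumes "i \<noteq> b"
  shows "near_int (of_int (2 ^ i) / 2 ^ Suc b)"
proof -
  obtain n r where 1: "(2::real) ^ i / 2 ^ Suc b = of_int n + r" "0 \<le> r" "r \<le> 1/4"
    using pow2_ratio_cases[OF assms(1)] by blast
  then show ?thesis by (intro near_intI[of _ n]) (auto simp: abs_le_iff)
qed

text \<open>For \<open>b < e + 3\<close> the last two terms are integers. For
  \<open>e + 5 <= b\<close> the first two add up to -7 times a number of size at most 1/64, which
  the nonnegative remainder of the third term tolerates.\<close>

lemma near_int_pow2_triple:
  assumes "b < e \<or> b = e + 1 \<or> b = e + 2 \<or> e + 5 \<le> b" "e + 4 \<le> j" "b \<noteq> j"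
  shows "near_int (of_int (2 ^ e - 2 ^ (e + 3) + 2 ^ j) / 2 ^ Suc b)"
proof -
  have eq: "of_int (2 ^ e - 2 ^ (e + 3) + 2 ^ j) / 2 ^ Suc b
      = (2::real) ^ e / 2 ^ Suc b - 2 ^ (e + 3) / 2 ^ Suc b + 2 ^ j / 2 ^ Suc b"
    by (simp add: diff_divide_distrib add_divide_distrib)
  show ?thesis
  proof (cases "e + 5 \<le> b")
    case True
    define z where "z = (2::real) ^ e / 2 ^ Suc b"
    have z: "0 < z" "z \<le> 1/64" using pow2_ratio_less[OF True] by (auto simp: z_def)
    have z8: "(2::real) ^ (e + 3) / 2 ^ Suc b = 8 * z" by (simp add: z_def power_add)
    obtain m s where s: "(2::real) ^ j / 2 ^ Suc b = of_int m + s" "0 \<le> s" "s \<le> 1/4"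
      using pow2_ratio_cases[of j b] assms by blast
    have "of_int (2 ^ e - 2 ^ (e + 3) + 2 ^ j) / 2 ^ Suc b = s - 7 * z + of_int m"
      unfolding eq z8 s(1) z_def[symmetric] by simp
    then show ?thesis by (rule near_int_add_of_intI) (use s z in linarith)+
  next
    case False
    then have b: "b < e + 3" using assms by auto
    obtain m where m: "(2::real) ^ j / 2 ^ Suc b = of_int m"
      using pow2_ratio_ge[of b j] assms b by auto
    obtain l where l: "(2::real) ^ (e + 3) / 2 ^ Suc b = of_int l"
      using pow2_ratio_ge[of b "e + 3"] b by auto
    obtain n r where r: "(2::real) ^ e / 2 ^ Suc b = of_int n + r" "0 \<le> r" "r \<le> 1/4"
      using pow2_ratio_cases[of e b] assms False by force
    have "of_int (2 ^ e - 2 ^ (e + 3) + 2 ^ j) / 2 ^ Suc b = r + of_int (n - l + m)"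
      unfolding eq m l r(1) by simp
    then show ?thesis by (rule near_int_add_of_intI) (use r in linarith)+
  qed
qed

section \<open>The orbit of a point under doubling\<close>

text \<open>Starting at \<open>v\<close> on the side \<open>\<sigma>\<close> of an integer, doubling
  reaches (1/8, 1/4]; the next doubling lies in (1/4, 1/2], which is allowed only at an exponent in
  \<open>A\<close>.\<close>

lemma crossing:
  fixes u v \<sigma> :: real
  assumes single: "\<And>i. i \<notin> A \<Longrightarrow> near_int (2 ^ i * u)"
    and eq: "2 ^ i * u = \<sigma> * v + of_int n"
    and sgn: "\<sigma> = 1 \<or> \<sigma> = -1"
    and v: "0 < v" "v \<le> 1/4"
  obtains f m where "1/8 < 2 ^ f * v" "2 ^ f * v \<le> 1/4" "Suc (i + f) \<in> A"
    "2 ^ (i + f) * u = \<sigma> * (2 ^ f * v) + of_int m"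
proof -
  obtain f where f: "1/8 < 2 ^ f * v" "2 ^ f * v \<le> 1/4" using scale_to_quarter[OF v] .
  have mult: "2 ^ (i + d) * u = \<sigma> * (2 ^ d * v) + of_int (2 ^ d * n)" for d
  proof -
    have "2 ^ (i + d) * u = 2 ^ d * (2 ^ i * u)" by (simp add: power_add)
    then show ?thesis unfolding eq by (simp add: algebra_simps)
  qed
  have "Suc (i + f) \<in> A"
  proof (rule ccontr)
    assume "Suc (i + f) \<notin> A"
    then have "near_int (2 ^ (i + Suc f) * u)" by (intro single) simp
    then have "near_int (\<sigma> * (2 ^ Suc f * v))" unfolding mult near_int_add_of_int .
    then have "near_int (2 ^ Suc f * v)" using sgn by (auto simp: near_int_uminus)
    moreover have "1/4 < 2 ^ Suc f * v" "2 ^ Suc f * v \<le> 1/2" using f by simp_all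
    ultimately show False using near_int_small[of "2 ^ Suc f * v"] unfolding abs_le_iff by linarith
  qed
  then show ?thesis using that f mult by blast
qed

text \<open>Here \<open>4 * w\<close> lies strictly between 1/2 and 1, so being near an integer
  forces it to be at least 3/4: the orbit returns close to an integer, on the opposite side.\<close>

lemma after_crossing:
  fixes u w \<sigma> :: real
  assumes near: "near_int (2 ^ (i + 2) * u)"
    and eq: "2 ^ i * u = \<sigma> * w + of_int n"
    and sgn: "\<sigma> = 1 \<or> \<sigma> = -1"
    and w: "1/8 < w" "w < 1/4"
  shows "3/16 \<le> w" "\<exists>m::int. 2 ^ (i + 2) * u = - \<sigma> * (1 - 4 * w) + of_int m"
proof -
  have "2 ^ (i + 2) * u = 4 * (2 ^ i * u)" by (simp add: power_add)
  then have 4: "2 ^ (i + 2) * u = \<sigma> * (4 * w) + of_int (4 * n)" unfolding eq by simp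
  then have "near_int (\<sigma> * (4 * w))" using near near_int_add_of_int by metis
  then have "near_int (4 * w)" using sgn by (auto simp: near_int_uminus)
  then show "3/16 \<le> w" using near_int_gap[of "4 * w" 0] w by auto
  have "2 ^ (i + 2) * u = - \<sigma> * (1 - 4 * w) + of_int (4 * n + (if \<sigma> = 1 then 1 else - 1))"
    using sgn unfolding 4 by auto
  then show "\<exists>m::int. 2 ^ (i + 2) * u = - \<sigma> * (1 - 4 * w) + of_int m" by blast
qed

text \<open>\<open>A\<close> plays the range of the sequence, and \<open>adm\<close> says that
  \<open>u\<close> passes the test of every integer multiplication in the polar.\<close>

lemma dyadic_unit_if_admissible:
  fixes A :: "nat set" and u :: real
  assumes zero: "0 \<notin> A"
    and uniq: "\<And>i j. i \<in> A \<Longrightarrow> Suc i \<in> A \<Longrightarrow> j \<in> A \<Longrightarrow> Suc j \<in> A \<Longrightarrow> i = j"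
    and far: "\<And>i. i \<in> A \<Longrightarrow> Suc i \<in> A \<Longrightarrow> i + 3 \<notin> A"
    and adm: "\<And>k. (\<forall>b\<in>A. near_int (of_int k / 2 ^ Suc b)) \<Longrightarrow> near_int (of_int k * u)"
    and u: "0 < u" "u \<le> 1/4"
  shows "\<exists>b\<in>A. u = 1 / 2 ^ Suc b"
proof -
  have single: "near_int (2 ^ i * u)" if "i \<notin> A" for i
    using adm[of "2 ^ i"] near_int_pow2[of i] that by (metis of_int_numeral of_int_power)
  have double: "near_int (2 ^ i * u - 2 ^ j * u)" if "i \<notin> A" "j \<notin> A" for i j
    using adm[of "2 ^ i - 2 ^ j"] near_int_pow2_diff[of i _ j] that
    by (metis left_diff_distrib of_int_diff of_int_numeral of_int_power)
  \<comment> \<open>Applied to two orbit positions on opposite sides of the integers, so that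
    \<open>y\<close> is negative and \<open>x - y\<close> adds up both distances.\<close>
  have split: "2 ^ i * u - 2 ^ j * u \<noteq> x - y + of_int n"
    if "i \<notin> A" "j \<notin> A" "1/4 < x - y" "x - y < 3/4" for i j x y n
    using double[OF that(1,2)] near_int_gap[of "x - y" 0] that near_int_add_of_int[of "x - y" n] by auto
  obtain e where e: "1/8 < 2 ^ e * u" "2 ^ e * u \<le> 1/4" "Suc e \<in> A"
    using crossing[of A u 0 1 u 0] single u by auto
  define t where "t = 2 ^ e * u"
  have t: "1/8 < t" "t \<le> 1/4" using e by (auto simp: t_def)
  have eA: "Suc e \<in> A" by fact
  show ?thesis
  proof (cases "t = 1/4")
    case True
    then have "u = 1 / 2 ^ Suc (Suc e)" unfolding t_def by (simp add: field_simps)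
    with eA show ?thesis by blast
  next
    case False
    with t have t: "1/8 < t" "t < 1/4" by auto
    have False
    proof (cases "e + 2 \<in> A")
      case pair: True
      have notA: "e \<notin> A" "e + 3 \<notin> A" "e + 4 \<notin> A"
        using uniq[of e "Suc e"] uniq[of "Suc e" "e + 2"] far[of "Suc e"] eA pair
        by (auto simp: eval_nat_numeral)
      have tail: "Suc j \<notin> A" if "j \<in> A" "e + 2 \<le> j" for j
        using uniq[of "Suc e" j] that eA pair by auto
      have 8: "2 ^ (e + 3) * u = 8 * t" by (simp add: t_def power_add)
      have "near_int (8 * t)" using single[OF notA(2)] 8 by simp
      \<comment> \<open>As \<open>e + 2\<close> is in \<open>A\<close>, nothing is known about
        \<open>4 * t\<close>; the first usable position is \<open>8 * t\<close>, just above 1 (same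
        side as \<open>t\<close>) or just below 2 (opposite side).\<close>
      then consider "8 * t \<le> 5/4" | "7/4 \<le> 8 * t"
        using near_int_gap[of "8 * t" 1] t by fastforce
      then show False
      proof cases
        case 1
        define v where "v = 8 * t - 1"
        have v: "0 < v" "v \<le> 1/4" using t 1 by (auto simp: v_def)
        obtain f n where f: "1/8 < 2 ^ f * v" "2 ^ f * v \<le> 1/4" "Suc (e + 3 + f) \<in> A"
          and fu: "2 ^ (e + 3 + f) * u = 1 * (2 ^ f * v) + of_int n"
          by (rule crossing[of A u "e + 3" 1 v 1]) (use single v in \<open>auto simp: 8 v_def\<close>)
        define w where "w = 2 ^ f * v"
        have f1: "1 \<le> f" using f(3) notA by (cases f) (auto simp: eval_nat_numeral)
        have fA: "e + 3 + f \<notin> A" "Suc (Suc (e + 3 + f)) \<notin> A" using tail[of "e + 3 + f"] tail[OF f(3)] f(3) by auto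
        show False
        proof (cases "w = 1/4")
          \<comment> \<open>No third return: \<open>u\<close> is a sum of two powers of 1/2, and the
            three-term multiplier is needed.\<close>
          case True
          have "(2::real) ^ 1 \<le> 2 ^ f" using f1 by (intro power_increasing) auto
          then have v2: "2 * v \<le> w" using v unfolding w_def by (intro mult_right_mono) auto
          have "near_int (of_int (2 ^ e - 2 ^ (e + 3) + 2 ^ (e + 3 + f)) * u)"
          proof (rule adm, intro ballI near_int_pow2_triple)
            fix b assume b: "b \<in> A"
            have "b \<noteq> e" "b \<noteq> e + 3" "b \<noteq> e + 4" using b notA by auto
            then show "b < e \<or> b = e + 1 \<or> b = e + 2 \<or> e + 5 \<le> b" by linarith
            show "b \<noteq> e + 3 + f" using fA b by auto
          qed (use f1 in simp)
          moreover have "of_int (2 ^ e - 2 ^ (e + 3) + 2 ^ (e + 3 + f)) * u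
              = 2 ^ e * u - 2 ^ (e + 3) * u + 2 ^ (e + 3 + f) * u"
            by (simp add: algebra_simps)
          moreover have "\<dots> = (t - v + 1/4) + of_int (n - 1)"
            unfolding fu 8 t_def[symmetric] using True by (simp add: v_def w_def)
          ultimately have "near_int (t - v + 1/4)" by (metis near_int_add_of_int)
          \<comment> \<open>With \<open>t = (1 + v) / 8\<close> and \<open>v \<le> 1/8\<close>, the
            value is \<open>3/8 - 7 * v / 8\<close>, which lies strictly between 1/4 and
            3/8.\<close>
          then show False
            using near_int_gap[of "t - v + 1/4" 0] v2 True v t by (auto simp: v_def)
        next
          case False
          then have w: "1/8 < w" "w < 1/4" using f by (auto simp: w_def)
          have "near_int (2 ^ (e + 3 + f + 2) * u)" using fA by (intro single) simp
          note after = after_crossing[OF this fu, folded w_def, OF disjI1[OF refl] w]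
          obtain n' where n': "2 ^ (e + 3 + f + 2) * u = - 1 * (1 - 4 * w) + of_int n'"
            using after(2) by blast
          \<comment> \<open>The third return is on the side opposite to \<open>t\<close>, so a
            two-term multiplier suffices.\<close>
          obtain h m where h: "1/8 < 2 ^ h * (1 - 4 * w)" "2 ^ h * (1 - 4 * w) \<le> 1/4"
            "Suc (e + 3 + f + 2 + h) \<in> A"
            and hu: "2 ^ (e + 3 + f + 2 + h) * u = - 1 * (2 ^ h * (1 - 4 * w)) + of_int m"
            by (rule crossing[OF single n']) (use w after(1) in auto)
          have "e + 3 + f + 2 + h \<notin> A" using tail[of "e + 3 + f + 2 + h"] h(3) by auto
          with split[OF notA(1) this, of t "- (2 ^ h * (1 - 4 * w))" "- m"] show False
            using h t unfolding hu t_def[symmetric] by simp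
        qed
      next
        case 2
        have 4: "2 ^ (e + 2) * u = - 1 * (1 - 4 * t) + of_int 1" by (simp add: t_def power_add)
        obtain f n where f: "1/8 < 2 ^ f * (1 - 4 * t)" "2 ^ f * (1 - 4 * t) \<le> 1/4"
          "Suc (e + 2 + f) \<in> A"
          and fu: "2 ^ (e + 2 + f) * u = - 1 * (2 ^ f * (1 - 4 * t)) + of_int n"
          by (rule crossing[OF single 4]) (use t 2 in auto)
        have "f \<noteq> 0" using f(3) notA by (intro notI) (auto simp: eval_nat_numeral)
        then have "e + 2 + f \<notin> A" using tail[of "e + 2 + f"] f(3) by auto
        with split[OF notA(1) this, of t "- (2 ^ f * (1 - 4 * t))" "- n"] show False
          using f t 2 unfolding fu t_def[symmetric] by simp
      qed
    next
      case e2: False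
      have "2 ^ e * u = 1 * t + of_int 0" by (simp add: t_def)
      note after = after_crossing[OF single[OF e2] this disjI1[OF refl] t]
      obtain n where n: "2 ^ (e + 2) * u = - 1 * (1 - 4 * t) + of_int n" using after(2) by blast
      have t3: "3/16 \<le> t" by (fact after(1))
      obtain f m where f: "1/8 < 2 ^ f * (1 - 4 * t)" "2 ^ f * (1 - 4 * t) \<le> 1/4"
        "Suc (e + 2 + f) \<in> A"
        and fu: "2 ^ (e + 2 + f) * u = - 1 * (2 ^ f * (1 - 4 * t)) + of_int m"
        by (rule crossing[OF single n]) (use t t3 in auto)
      define w where "w = 2 ^ f * (1 - 4 * t)"
      have w: "1/8 < w" "w \<le> 1/4" using f by (auto simp: w_def)
      \<comment> \<open>If at least one doubling occurs before the second crossing, then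
        \<open>1 - 4 * t\<close> is at most 1/8 instead of 1/4.\<close>
      have improve: "7/32 \<le> t" if "f \<noteq> 0"
      proof -
        have "(2::real) ^ 1 \<le> 2 ^ f" using that by (intro power_increasing) auto
        then have "2 * (1 - 4 * t) \<le> w" using t unfolding w_def by (intro mult_right_mono) auto
        then show ?thesis using w by auto
      qed
      show False
      proof (cases "e \<in> A")
        case eA': True
        \<comment> \<open>The exponent \<open>e\<close> is forbidden in a multiplier, so its
          predecessor is used. This halves \<open>t\<close>, and the sharper bounds 7/32 on
          \<open>t\<close> and 3/16 on \<open>w\<close> compensate: 7/64 + 3/16 exceeds 1/4.\<close>
        then obtain d where d: "e = Suc d" using zero by (cases e) auto
        have dA: "d \<notin> A" using uniq[of d e] eA' eA d by auto
        have tail: "Suc j \<notin> A" if "j \<in> A" "e < j" for j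
          using uniq[of e j] that eA eA' by auto
        have "f \<noteq> 0" using f(3) far[of e] eA eA' by (intro notI) (auto simp: eval_nat_numeral)
        note t7 = improve[OF this]
        have w3: "3/16 \<le> w"
        proof (cases "w = 1/4")
          case False
          have "near_int (2 ^ (e + 2 + f + 2) * u)"
            using tail[OF f(3)] by (intro single) simp
          from after_crossing(1)[OF this fu, folded w_def] w False show ?thesis by auto
        qed auto
        have "e + 2 + f \<notin> A" using tail[of "e + 2 + f"] f(3) by auto
        moreover have "2 ^ d * u = t / 2" by (simp add: t_def d)
        ultimately show False
          using split[OF dA, of "e + 2 + f" "t / 2" "- w" "- m"] t t7 w3 w
          unfolding fu by (simp add: w_def)
      next
        case eA': False
        show False
        proof (cases "e + 2 + f \<in> A")
          case False
          then show False
            using split[OF eA' False, of t "- w" "- m"] t t3 w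
            unfolding fu t_def[symmetric] by (simp add: w_def)
        next
          case pair: True
          \<comment> \<open>Now the second exponent is forbidden and is lowered by one, which halves
            \<open>w\<close>; 7/32 + 1/16 still exceeds 1/4.\<close>
          then obtain g where g: "f = Suc g" using e2 by (cases f) auto
          have "e + 2 + g \<notin> A" using uniq[of "e + 2 + g" "e + 2 + f"] pair f(3) g by auto
          moreover have "2 ^ (e + 2 + g) * u = - (w / 2) + of_int (2 ^ g * n)"
          proof -
            have "2 ^ (e + 2 + g) * u = 2 ^ g * (2 ^ (e + 2) * u)" by (simp add: power_add)
            moreover have "w / 2 = 2 ^ g * (1 - 4 * t)" by (simp add: w_def g)
            ultimately show ?thesis unfolding n by (simp add: algebra_simps)
          qed
          moreover have "7/32 \<le> t" using improve g by simp
          ultimately show False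
            using split[OF eA', of "e + 2 + g" t "- (w / 2)" "- (2 ^ g * n)"] t w
            by (simp add: t_def)
        qed
      qed
    qed
    then show ?thesis ..
  qed
qed

section \<open>Necessity\<close>

text \<open>The integer by which \<open>z\<close> differs from plus or minus a power of 1/2 has
  absolute value below 1, hence is 0, and positivity of \<open>z\<close> excludes the minus
  sign.\<close>

lemma in_K2D:
  assumes "to_circle z \<in> K2 a" "0 < z" "z < 1/2"
  shows "\<exists>b. z = 1 / 2 ^ b"
proof -
  have *: "\<exists>b. z = 1 / 2 ^ b" if \<sigma>: "\<sigma> = 1 \<or> \<sigma> = -1" "z - \<sigma> * (1 / 2 ^ Suc b) \<in> \<int>" for \<sigma> :: real and b
  proof -
    have r: "0 < 1 / (2::real) ^ Suc b" "1 / (2::real) ^ Suc b \<le> 1/2"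
      using power_increasing[of 0 b "2::real"] by (auto simp: field_simps)
    obtain n where n: "z - \<sigma> * (1 / 2 ^ Suc b) = of_int n" using \<sigma>(2) by (auto elim: Ints_cases)
    define q where "q = 1 / (2::real) ^ Suc b"
    have n': "z - \<sigma> * q = of_int n" and q: "0 < q" "q \<le> 1/2" using n r by (simp_all only: q_def)
    have "-1 < real_of_int n" "real_of_int n < 1"
      using \<sigma>(1) n' q assms by auto
    then have "n = 0" by linarith
    then have "z = q" using \<sigma>(1) n' q assms by auto
    then have "z = 1 / 2 ^ Suc b" by (simp only: q_def)
    then show ?thesis by blast
  qed
  have "z \<notin> \<int>" using assms by (auto elim!: Ints_cases)
  then have "to_circle z \<noteq> 0" unfolding to_circle_0[symmetric] to_circle_eq_iff by simp
  then obtain n where "to_circle z = dyadic_pt a n \<or> to_circle z = - dyadic_pt a n"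
    using assms(1) unfolding K2_def by blast
  then show ?thesis
    using *[of 1 "a n"] *[of "-1" "a n"]
    by (auto simp: dyadic_pt_def to_circle_eq_iff simp flip: to_circle_minus)
qed

text \<open>Common frame for the counterexamples: a point strictly between consecutive powers of 1/2
  lies outside \<open>K2 a\<close>.\<close>

lemma not_quasi_convex_K2:
  assumes z: "1 / 2 ^ Suc (Suc N) < z" "z < 1 / 2 ^ Suc N"
    and pol: "\<And>\<phi>. \<phi> \<in> characters \<Longrightarrow> (\<And>n. \<phi> (dyadic_pt a n) \<in> circle_plus) \<Longrightarrow> \<phi> (to_circle z) \<in> circle_plus"
  shows "\<not> quasi_convex (K2 a)"
proof
  assume "quasi_convex (K2 a)"
  then have "prepolar (polar (K2 a)) \<subseteq> K2 a" by (simp add: quasi_convex_iff)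
  then have K: "to_circle z \<in> K2 a" using pol by (auto simp: prepolar_def polar_K2)
  have "0 < 1 / (2::real) ^ Suc (Suc N)" by simp
  then have "0 < z" using z by linarith
  moreover have "1 / (2::real) ^ Suc N \<le> 1/2"
    using power_increasing[of 0 N "2::real"] by (auto simp: field_simps)
  then have "z < 1/2" using z by linarith
  ultimately obtain b where b: "z = 1 / 2 ^ b" using in_K2D[OF K] by blast
  have "(2::real) ^ b < 2 ^ Suc (Suc N)" "(2::real) ^ Suc N < 2 ^ b"
    using z unfolding b by (simp_all add: divide_simps split: if_splits)
  then have "b < Suc (Suc N)" "Suc N < b" by (simp_all only: power_strict_increasing_iff[of "2::real"] one_less_numeral_iff semiring_norm)
  then show False by simp
qed

text \<open>The double of a representative in [-1/4, 1/4] lies in [-1/2, 1/2], where being near an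
  integer means being near 0.\<close>

lemma character_dyadic_half:
  assumes "\<phi> \<in> characters"
    and "\<phi> (to_circle (1 / 2 ^ Suc b)) \<in> circle_plus" "\<phi> (to_circle (1 / 2 ^ Suc (Suc b))) \<in> circle_plus"
  obtains w where "\<phi> (to_circle (1 / 2 ^ Suc (Suc b))) = to_circle w" "\<bar>w\<bar> \<le> 1/8"
proof -
  obtain w where w: "\<phi> (to_circle (1 / 2 ^ Suc (Suc b))) = to_circle w" "\<bar>w\<bar> \<le> 1/4"
    using assms(3) circle_plusE by metis
  have "near_int (2 * w)"
    using assms(2) character_multiple[OF assms(1) w(1), of 2] by (simp add: to_circle_in_circle_plus)
  then have "\<bar>2 * w\<bar> \<le> 1/4" using w(2) by (intro near_int_small) auto
  with w that show ?thesis by auto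
qed

section \<open>One counterexample for each way the conditions can fail\<close>

text \<open>A polar character kills 1/2: twice its value there is 0, and 0 is the only such point of
  \<open>circle_plus\<close>. The third term of the sequence is taken because the second may be 1/4,
  and 1/2 - 1/4 lies in the set.\<close>

lemma not_quasi_convex_if_zero:
  assumes "strict_mono a" "a 0 = 0"
  shows "\<not> quasi_convex (K2 a)"
proof (rule not_quasi_convex_K2)
  have "a 0 < a 1" "a 1 < a 2" using assms(1) by (auto intro: strict_monoD)
  then have "2 \<le> a 2" by linarith
  then have "(2::real) ^ 3 \<le> 2 ^ Suc (a 2)" by (intro power_increasing) auto
  then have "1 / (2::real) ^ Suc (a 2) \<le> 1/8" by (simp add: field_simps)
  then show "1 / 2 ^ Suc (Suc 0) < 1/2 - 1 / (2::real) ^ Suc (a 2)" by simp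
  show "1/2 - 1 / (2::real) ^ Suc (a 2) < 1 / 2 ^ Suc 0" by simp
  fix \<phi> :: "circle \<Rightarrow> circle"
  assume \<phi>: "\<phi> \<in> characters" "\<And>n. \<phi> (dyadic_pt a n) \<in> circle_plus"
  obtain v where v: "\<phi> (to_circle (1/2)) = to_circle v" "\<bar>v\<bar> \<le> 1/4"
    using \<phi>(2)[of 0] assms(2) circle_plusE unfolding dyadic_pt_def by (metis add_0 power_one_right)
  have "to_circle 1 = to_circle 0" by (simp add: to_circle_eq_iff)
  then have "to_circle (2 * v) = to_circle 0"
    using character_multiple[OF \<phi>(1) v(1), of 2] character_0[OF \<phi>(1)] by (simp add: to_circle_0)
  then have "2 * v \<in> \<int>" by (simp add: to_circle_eq_iff)
  then obtain n where "2 * v = of_int n" by (auto elim: Ints_cases)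
  moreover from this have "-1 < real_of_int n" "real_of_int n < 1" using v(2) by linarith+
  then have "n = 0" by linarith
  ultimately have "v = 0" by simp
  then have "\<phi> (to_circle (1/2 + - (1 / 2 ^ Suc (a 2)))) = - \<phi> (dyadic_pt a 2)"
    unfolding to_circle_add to_circle_minus character_add[OF \<phi>(1)] character_uminus[OF \<phi>(1)]
      v(1) dyadic_pt_def by (simp add: to_circle_0)
  then show "\<phi> (to_circle (1/2 - 1 / 2 ^ Suc (a 2))) \<in> circle_plus"
    using \<phi>(2) by (simp add: uminus_circle_plus)
qed

lemma not_quasi_convex_if_triple:
  assumes "p \<in> range a" "Suc p \<in> range a" "p + 2 \<in> range a"
  shows "\<not> quasi_convex (K2 a)"
proof (rule not_quasi_convex_K2)
  show "1 / 2 ^ Suc (Suc p) < 3 * (1 / (2::real) ^ Suc (Suc (Suc p)))"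
    "3 * (1 / (2::real) ^ Suc (Suc (Suc p))) < 1 / 2 ^ Suc p"
    by (simp_all add: field_simps)
  fix \<phi> :: "circle \<Rightarrow> circle"
  assume \<phi>: "\<phi> \<in> characters" "\<And>n. \<phi> (dyadic_pt a n) \<in> circle_plus"
  have plus: "\<phi> (to_circle (1 / 2 ^ Suc b)) \<in> circle_plus" if "b \<in> range a" for b
    using \<phi>(2) that unfolding dyadic_pt_def by (metis Suc_eq_plus1 imageE)
  obtain v where v: "\<phi> (to_circle (1 / 2 ^ Suc (Suc (Suc p)))) = to_circle v" "\<bar>v\<bar> \<le> 1/8"
    using character_dyadic_half[OF \<phi>(1) plus plus, of "Suc p"] assms by auto
  have "\<phi> (to_circle (4 * (1 / 2 ^ Suc (Suc (Suc p))))) = to_circle (4 * v)"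
    using character_multiple[OF \<phi>(1) v(1), of 4] by simp
  then have "near_int (4 * v)"
    using plus[OF assms(1)] by (simp add: to_circle_in_circle_plus)
  \<comment> \<open>Being near an integer now confines \<open>v\<close> to [-1/16, 1/16], so
    \<open>3 * v\<close> stays within 3/16.\<close>
  then have "\<bar>4 * v\<bar> \<le> 1/4" using v(2) by (intro near_int_small) auto
  then have "near_int (3 * v)" by (intro near_intI[of _ 0]) auto
  then show "\<phi> (to_circle (3 * (1 / 2 ^ Suc (Suc (Suc p))))) \<in> circle_plus"
    using character_multiple[OF \<phi>(1) v(1), of 3] by (simp add: to_circle_in_circle_plus)
qed

text \<open>Up to sign, the two conditions leave only [0, 1/32] and [7/32, 1/4] for
  \<open>v\<close>; there \<open>5 * v\<close> is close to 0 and to 1 respectively.\<close>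

lemma near_int_5:
  assumes v: "\<bar>v\<bar> \<le> 1/4" and 4: "near_int (4 * v)" and 8: "near_int (8 * v)"
  shows "near_int (5 * v)"
proof -
  have nonneg: "near_int (5 * v)" if "0 \<le> v" "v \<le> 1/4" "near_int (4 * v)" "near_int (8 * v)" for v
  proof (cases "v \<le> 1/20")
    case True
    then show ?thesis using that by (intro near_intI[of _ 0]) auto
  next
    case False
    have "v \<le> 1/16 \<or> 3/16 \<le> v"
      using near_int_gap[OF that(3), of 0] that False by fastforce
    moreover have "v \<le> 1/32 \<or> 3/32 \<le> v" if "v < 1/8"
      using near_int_gap[OF \<open>near_int (8 * v)\<close>, of 0] that False by auto
    moreover have "v \<le> 5/32 \<or> 7/32 \<le> v" if "1/8 < v" "v < 1/4"
      using near_int_gap[OF \<open>near_int (8 * v)\<close>, of 1] that by auto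
    ultimately have "7/32 \<le> v" using False that(2) by fastforce
    then show ?thesis using that by (intro near_intI[of _ 1]) (simp add: abs_le_iff)
  qed
  show ?thesis
    using nonneg[of v] nonneg[of "- v"] assms near_int_uminus[of "4 * v"] near_int_uminus[of "8 * v"]
      near_int_uminus[of "5 * v"] by (cases "0 \<le> v") auto
qed

lemma not_quasi_convex_if_close:
  assumes "p \<in> range a" "Suc p \<in> range a" "p + 3 \<in> range a"
  shows "\<not> quasi_convex (K2 a)"
proof (rule not_quasi_convex_K2)
  show "1 / 2 ^ Suc (Suc p) < 5 * (1 / (2::real) ^ Suc (p + 3))"
    "5 * (1 / (2::real) ^ Suc (p + 3)) < 1 / 2 ^ Suc p"
    by (simp_all add: field_simps power_add)
  fix \<phi> :: "circle \<Rightarrow> circle"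
  assume \<phi>: "\<phi> \<in> characters" "\<And>n. \<phi> (dyadic_pt a n) \<in> circle_plus"
  have plus: "\<phi> (to_circle (1 / 2 ^ Suc b)) \<in> circle_plus" if "b \<in> range a" for b
    using \<phi>(2) that unfolding dyadic_pt_def by (metis Suc_eq_plus1 imageE)
  obtain v where v: "\<phi> (to_circle (1 / 2 ^ Suc (p + 3))) = to_circle v" "\<bar>v\<bar> \<le> 1/4"
    using circle_plusE[OF plus[OF assms(3)]] .
  note mult = character_multiple[OF \<phi>(1) v(1)]
  \<comment> \<open>In units of the smallest of the three points, the others are the multiples 4 and
    8, and the new point is the multiple 5.\<close>
  have "real 4 * (1 / 2 ^ Suc (p + 3)) = 1 / 2 ^ Suc (Suc p)"
    "real 8 * (1 / 2 ^ Suc (p + 3)) = 1 / 2 ^ Suc p" by (simp_all add: power_add)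
  then have "near_int (4 * v)" "near_int (8 * v)"
    using plus[OF assms(1)] plus[OF assms(2)] mult[of 4] mult[of 8] to_circle_in_circle_plus
    by (metis of_nat_numeral)+
  then have "near_int (5 * v)" using v(2) by (intro near_int_5)
  then show "\<phi> (to_circle (5 * (1 / 2 ^ Suc (p + 3)))) \<in> circle_plus"
    using mult[of 5] by (simp add: to_circle_in_circle_plus)
qed

lemma not_quasi_convex_if_two_pairs:
  assumes "p \<in> range a" "Suc p \<in> range a" "q \<in> range a" "Suc q \<in> range a" "Suc p < q"
  shows "\<not> quasi_convex (K2 a)"
proof (rule not_quasi_convex_K2)
  show "1 / 2 ^ Suc (Suc p) < 1 / 2 ^ Suc (Suc p) + 1 / (2::real) ^ Suc (Suc q)" by simp
  have "1 / (2::real) ^ Suc (Suc q) < 1 / 2 ^ Suc (Suc p)"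
    using assms(5) by (intro divide_strict_left_mono power_strict_increasing) auto
  then show "1 / 2 ^ Suc (Suc p) + 1 / (2::real) ^ Suc (Suc q) < 1 / 2 ^ Suc p" by simp
  fix \<phi> :: "circle \<Rightarrow> circle"
  assume \<phi>: "\<phi> \<in> characters" "\<And>n. \<phi> (dyadic_pt a n) \<in> circle_plus"
  have plus: "\<phi> (to_circle (1 / 2 ^ Suc b)) \<in> circle_plus" if "b \<in> range a" for b
    using \<phi>(2) that unfolding dyadic_pt_def by (metis Suc_eq_plus1 imageE)
  obtain v where v: "\<phi> (to_circle (1 / 2 ^ Suc (Suc p))) = to_circle v" "\<bar>v\<bar> \<le> 1/8"
    using character_dyadic_half[OF \<phi>(1) plus plus, OF assms(1,2)] .
  obtain w where w: "\<phi> (to_circle (1 / 2 ^ Suc (Suc q))) = to_circle w" "\<bar>w\<bar> \<le> 1/8"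
    using character_dyadic_half[OF \<phi>(1) plus plus, OF assms(3,4)] .
  have "\<bar>v + w\<bar> \<le> 1/4" using v(2) w(2) by linarith
  then have "near_int (v + w)" by (intro near_intI[of _ 0]) simp
  then show "\<phi> (to_circle (1 / 2 ^ Suc (Suc p) + 1 / 2 ^ Suc (Suc q))) \<in> circle_plus"
    unfolding to_circle_add character_add[OF \<phi>(1)] v(1) w(1)
    by (simp add: to_circle_in_circle_plus flip: to_circle_add)
qed

section \<open>The characterization\<close>

lemma quasi_convex_K2_if:
  assumes zero: "0 \<notin> range a"
    and uniq: "\<And>i j. i \<in> range a \<Longrightarrow> Suc i \<in> range a \<Longrightarrow> j \<in> range a \<Longrightarrow> Suc j \<in> range a \<Longrightarrow> i = j"
    and far: "\<And>i. i \<in> range a \<Longrightarrow> Suc i \<in> range a \<Longrightarrow> i + 3 \<notin> range a"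
  shows "quasi_convex (K2 a)"
  unfolding quasi_convex_iff
proof
  fix x assume x: "x \<in> prepolar (polar (K2 a))"
  have adm: "int_mult k x \<in> circle_plus" if "\<forall>b\<in>range a. near_int (of_int k / 2 ^ Suc b)" for k
    using x that unfolding int_mult_polar_K2[symmetric] by (simp add: prepolar_def)
  \<comment> \<open>Since 0 is outside the range, the identity is a polar character; this provides a
    representative \<open>u\<close> in [-1/4, 1/4].\<close>
  have "int_mult 1 x \<in> circle_plus"
  proof (rule adm, intro ballI)
    fix b assume "b \<in> range a"
    then have "0 \<noteq> b" using zero by metis
    from near_int_pow2[OF this] show "near_int (of_int 1 / 2 ^ Suc b)" by simp
  qed
  moreover have "int_mult 1 x = x" by transfer simp
  ultimately obtain u where u: "x = to_circle u" "\<bar>u\<bar> \<le> 1/4" using circle_plusE by metis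
  have adm: "near_int (of_int k * u)" if "\<forall>b\<in>range a. near_int (of_int k / 2 ^ Suc b)" for k
    using adm[OF that] unfolding u(1) int_mult_to_circle to_circle_in_circle_plus .
  then have adm': "near_int (of_int k * - u)" if "\<forall>b\<in>range a. near_int (of_int k / 2 ^ Suc b)" for k
    using that by (simp add: near_int_uminus)
  consider "u = 0" | "0 < u" | "0 < - u" by linarith
  then show "x \<in> K2 a"
  proof cases
    case 1
    then show ?thesis by (simp add: u K2_def to_circle_0)
  next
    case 2
    then obtain n where "u = 1 / 2 ^ Suc (a n)"
      using dyadic_unit_if_admissible[OF zero uniq far adm] u(2) by auto
    then have "x = dyadic_pt a n" by (simp add: u(1) dyadic_pt_def)
    then show ?thesis by (auto simp: K2_def)
  next
    case 3
    then obtain n where "- u = 1 / 2 ^ Suc (a n)"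
      using dyadic_unit_if_admissible[OF zero uniq far adm'] u(2) by auto
    then have "- x = dyadic_pt a n" by (simp add: u(1) dyadic_pt_def flip: to_circle_minus)
    then have "x = - dyadic_pt a n" by (metis minus_minus)
    then show ?thesis by (auto simp: K2_def)
  qed
qed

text \<open>Links the gap conditions to the range of \<open>a\<close>: by monotonicity, consecutive
  values can only occur at consecutive indices.\<close>

lemma consecutive_in_range_iff:
  assumes "strict_mono a"
  shows "i \<in> range a \<and> Suc i \<in> range a \<longleftrightarrow> (\<exists>n. i = a n \<and> gap a n = 1)"
proof
  assume "i \<in> range a \<and> Suc i \<in> range a"
  then obtain n m where nm: "i = a n" "Suc i = a m" by auto
  then have "n < m" using assms by (metis lessI strict_mono_less)
  then have "a (n + 1) \<le> a m" using assms by (simp add: strict_mono_less_eq)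
  moreover have "a n < a (n + 1)" using assms by (simp add: strict_mono_less)
  ultimately have "gap a n = 1" using nm by (simp add: gap_def)
  with nm show "\<exists>n. i = a n \<and> gap a n = 1" by blast
next
  assume "\<exists>n. i = a n \<and> gap a n = 1"
  then obtain n where "i = a n" "Suc i = a (n + 1)" unfolding gap_def by auto
  then show "i \<in> range a \<and> Suc i \<in> range a" by auto
qed

theorem theorem1:
  fixes a :: "nat \<Rightarrow> nat"
  assumes "strict_mono a"
  shows "quasi_convex (K2 a) \<longleftrightarrow>
    a 0 > 0 \<and>
    (\<exists>m. \<forall>n. n \<noteq> m \<longrightarrow> gap a n > 1) \<and>
    (\<forall>n. gap a n = 1 \<longrightarrow> gap a (n + 1) > 2)"
proof
  have less: "a n < a (n + 1)" for n using assms by (simp add: strict_mono_less)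
  have pair: "a n \<in> range a \<and> Suc (a n) \<in> range a" if "gap a n = 1" for n
    using consecutive_in_range_iff[OF assms] that by blast
  assume qc: "quasi_convex (K2 a)"
  have "a 0 > 0" using qc not_quasi_convex_if_zero[OF assms] by blast
  moreover have "gap a (n + 1) > 2" if n: "gap a n = 1" for n
  proof (rule ccontr)
    assume "\<not> gap a (n + 1) > 2"
    then have "a (n + 2) = a n + 2 \<or> a (n + 2) = a n + 3"
      using n less[of n] less[of "n + 1"] by (auto simp: gap_def)
    then have "a n + 2 \<in> range a \<or> a n + 3 \<in> range a" by (metis rangeI)
    then show False
      using qc pair[OF n] not_quasi_convex_if_triple not_quasi_convex_if_close by blast
  qed
  moreover have uniq: "n = m" if "gap a n = 1" "gap a m = 1" for n m
  proof -
    have False if nm: "n < m" "gap a n = 1" "gap a m = 1" for n m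
    proof (cases "m = n + 1")
      case True
      then show False using nm \<open>\<And>n. gap a n = 1 \<Longrightarrow> gap a (n + 1) > 2\<close>[of n] by simp
    next
      case False
      \<comment> \<open>Non-adjacent indices make the two pairs disjoint, as the two-pair
        counterexample requires.\<close>
      then have "a (n + 1) < a m" using nm assms by (simp add: strict_mono_less)
      then have "Suc (a n) < a m" using less[of n] by simp
      then show False using qc pair[OF nm(2)] pair[OF nm(3)] not_quasi_convex_if_two_pairs by blast
    qed
    then show ?thesis using that by (metis nat_neq_iff)
  qed
  moreover have "gap a n > 1" if "gap a n \<noteq> 1" for n
    using that less[of n] by (simp add: gap_def)
  then have "\<exists>m. \<forall>n. n \<noteq> m \<longrightarrow> gap a n > 1" using uniq by metis
  ultimately show "a 0 > 0 \<and> (\<exists>m. \<forall>n. n \<noteq> m \<longrightarrow> gap a n > 1) \<and>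
      (\<forall>n. gap a n = 1 \<longrightarrow> gap a (n + 1) > 2)" by blast
next
  assume R: "a 0 > 0 \<and> (\<exists>m. \<forall>n. n \<noteq> m \<longrightarrow> gap a n > 1) \<and>
    (\<forall>n. gap a n = 1 \<longrightarrow> gap a (n + 1) > 2)"
  show "quasi_convex (K2 a)"
  proof (rule quasi_convex_K2_if)
    have "a 0 \<le> a n" for n using assms by (simp add: strict_mono_less_eq)
    then show "0 \<notin> range a" using R by (metis imageE leD)
  next
    fix i j
    assume "i \<in> range a" "Suc i \<in> range a" "j \<in> range a" "Suc j \<in> range a"
    then obtain n m where "i = a n" "gap a n = 1" "j = a m" "gap a m = 1"
      using consecutive_in_range_iff[OF assms] by meson
    then show "i = j" using R by (metis less_irrefl)
  next
    fix i
    assume "i \<in> range a" "Suc i \<in> range a"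
    then obtain n where n: "i = a n" "gap a n = 1"
      using consecutive_in_range_iff[OF assms] by meson
    show "i + 3 \<notin> range a"
    proof
      assume "i + 3 \<in> range a"
      then obtain m where m: "i + 3 = a m" by auto
      \<comment> \<open>Hence \<open>a (n + 1) = i + 1\<close> and \<open>a (n + 2)\<close> is at
        least \<open>i + 4\<close>, so \<open>i + 3\<close> falls strictly between consecutive
        terms.\<close>
      have "gap a (n + 1) > 2" using R n by blast
      then have "a (n + 1) < a m" "a m < a (n + 2)" using n m by (auto simp: gap_def)
      then have "n + 1 < m" "m < n + 2" using assms by (simp_all only: strict_mono_less)
      then show False by simp
    qed
  qed
qed

end
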